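(* Let $(\Omega,\Sigma,\mathbb{P})$ be a probability space, let $\mathcal{X},\mathcal{Y}$ be real, Hausdorff, locally convex topological vector spaces, and let $\leq$ be any binary relation on $\mathcal{Y}$ (the canonical total order if $\mathcal{Y}=\mathbb{R}$), extended to $\overline{\mathcal{Y}}=\mathcal{Y}\cup\{\pm\infty\}$. Let $K\subseteq\mathcal{X}$, $f\colon K\to\mathcal{Y}$ and $X\colon\Omega\to K$ be such that the pair $(X,f(X))\colon\Omega\to\mathcal{X}\times\mathcal{Y}$ is weakly integrable. Let $g_l,g_u\colon\overline{\operatorname{Conv}(K)}\to\overline{\mathcal{Y}}$ be functions such that $$\overline{\operatorname{Conv}(\mathcal{G}(f))}\subseteq\{(x,y)\in\overline{\operatorname{Conv}(K)}\times\mathcal{Y} \mid g_l(x)\leq y\leq g_u(x)\},$$ i.e. $\overline{\operatorname{Conv}(\mathcal{G}(f))}|_x\subseteq[g_l(x),g_u(x)]$ for each $x\in\overline{\operatorname{Conv}(K)}$. Then $$g_l(\mathbb{E}[X])\leq\mathbb{E}[f(X)]\leq g_u(\mathbb{E}[X]).\qquad( * )$$ If $\mathcal{X}=\mathbb{R}^m$, $\mathcal{Y}=\mathbb{R}^n$ with $m,n\in\mathbb{N}$, then $\overline{\operatorname{Conv}(K)}$ and $\overline{\operatorname{Conv}(\mathcal{G}(f))}$ can be replaced by $\operatorname{Conv}(K)$ and $\operatorname{Conv}(\mathcal{G}(f))$, respectively (that is, $( * )$ holds whenever $g_l,g_u\colon\operatorname{Conv}(K)\to\overline{\mathcal{Y}}$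 satisfy $\operatorname{Conv}(\mathcal{G}(f))\subseteq\{(x,y)\in\operatorname{Conv}(K)\times\mathcal{Y}\mid g_l(x)\leq y\leq g_u(x)\}$). Further, for $\mathcal{Y}=\mathbb{R}$, $( * )$ is sharp in the following sense: (1) If $\mathcal{X}=\mathbb{R}^m$ and $g_l(x)=\inf(\operatorname{Conv}(\mathcal{G}(f))|_x)$ and $g_u(x)=\sup(\operatorname{Conv}(\mathcal{G}(f))|_x)$ for each $x\in\operatorname{Conv}(K)$, then, for every $x\in\operatorname{Conv}(K)$ and $y\in(g_l(x),g_u(x))$, there exist a probability space $(\tilde\Omega,\tilde\Sigma,\tilde{\mathbb{P}})$ and $\tilde X\colon\tilde\Omega\to K$ such that the pair $(\tilde X,f(\tilde X))$ is weakly integrable and $(\mathbb{E}[\tilde X],\mathbb{E}[f(\tilde X)])=(x,y)$. (2) In general (for an arbitrary real, Hausdorff, locally convex topological vector space $\mathcal{X}$), if $g_l(x)=\inf(\overline{\operatorname{Conv}(\mathcal{G}(f))}|_x)$ and $g_u(x)=\sup(\overline{\operatorname{Conv}(\mathcal{G}(f))}|_x)$ for each $x\in\overline{\operatorname{Conv}(K)}$, then, for every $x\in\overline{\operatorname{Conv}(K)}$ and $y\in(g_l(x),g_u(x))$ and for any neighborhood $U$ of $(x,y)$ in $\mathcal{X}\times\mathbb{R}$, there exist a probability space $(\tilde\Omega,\tilde\Sigma,\tilde{\mathbb{P}})$ and $\tilde X\colon\tilde\Omega\to K$ such that the pair $(\tilde X,f(\tilde X))$ is weakly integrable and $(\mathbb{E}[\tilde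 X],\mathbb{E}[f(\tilde X)])\in U$.
   Context: Notation: $f(X)$ denotes the composition $f\circ X$. A map $Z\colon\Omega\to\mathcal{Z}$ from a probability space into a real, Hausdorff, locally convex topological vector space $\mathcal{Z}$ with continuous dual $\mathcal{Z}'$ is weakly integrable if there exists $e\in\mathcal{Z}$ such that, for every $\ell\in\mathcal{Z}'$, $\ell(Z)\in L^1(\mathbb{P})$ and $\ell(e)=\int_\Omega\ell(Z)\,d\mathbb{P}$; then $\mathbb{E}[Z]:=e$. No measurability of $X$ itself is required. $\overline{A}$ is the closure of $A$, $\operatorname{Conv}(A)$ the convex hull of $A$ (all finite convex combinations of elements of $A$), and $\mathcal{G}(f)=\{(x,f(x))\mid x\in K\}\subseteq\mathcal{X}\times\mathcal{Y}$ the graph of $f$. For $M\subseteq\mathcal{X}\times\mathcal{Y}$ and $x\in\mathcal{X}$, $M|_x:=\{y\in\mathcal{Y}\mid(x,y)\in M\}$; $\overline{\operatorname{Conv}(\mathcal{G}(f))}|_x$ means the section of the closed set $\overline{\operatorname{Conv}(\mathcal{G}(f))}$. The added elements $\pm\infty$ of $\overline{\mathcal{Y}}$ satisfy $-\infty\leq y\leq\infty$ for each $y\in\mathcal{Y}$, and $[a,b]:=\{y\in\overline{\mathcal{Y}}\mid a\leq y\leq b\}$ for $a,b\in\overline{\mathcal{Y}}$. For $\mathcal{Y}=\mathbb{R}$, infima and suprema are taken in $[-\infty,\infty]$. *)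

theory Defs
  imports "HOL-Probability.Probability" "HOL-Library.Extended"
begin

class hausdorff_tvs = real_vector + t2_space + topological_ab_group_add +
  assumes tendsto_scaleR_nhds:
    "filterlim (\<lambda>p. fst p *\<^sub>R snd p) (nhds (c *\<^sub>R x)) (nhds c \<times>\<^sub>F nhds x)"

(* The constant convex cannot occur in a class assumption; its definition is written out. *)
class locally_convex_t2 = hausdorff_tvs +
  assumes convex_neighbourhood_base:
    "open U \<Longrightarrow> 0 \<in> U \<Longrightarrow> \<exists>V W.
       (\<forall>x\<in>V. \<forall>y\<in>V. \<forall>u\<ge>0. \<forall>v\<ge>0. u + v = 1 \<longrightarrow> u *\<^sub>R x + v *\<^sub>R y \<in> V) \<and>
       open W \<and> 0 \<in> W \<and> W \<subseteq> V \<and> V \<subseteq> U"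

lemma convex_neighbourhood:
  fixes U :: "'a::locally_convex_t2 set"
  assumes "open U" "0 \<in> U"
  shows "\<exists>V. convex V \<and> 0 \<in> interior V \<and> V \<subseteq> U"
  using convex_neighbourhood_base[OF assms] unfolding convex_def interior_def by blast

instance real_normed_vector \<subseteq> hausdorff_tvs
  by standard (intro tendsto_scaleR filterlim_fst filterlim_snd)

instance real_normed_vector \<subseteq> locally_convex_t2
proof
  fix U :: "'a set"
  assume "open U" "0 \<in> U"
  then obtain e where "e > 0" "ball 0 e \<subseteq> U"
    by (meson open_contains_ball)
  then show "\<exists>V W. (\<forall>x\<in>V. \<forall>y\<in>V. \<forall>u\<ge>0. \<forall>v\<ge>0. u + v = 1 \<longrightarrow> u *\<^sub>R x + v *\<^sub>R y \<in> V) \<and>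
       open W \<and> 0 \<in> W \<and> W \<subseteq> V \<and> V \<subseteq> U"
    using convex_ball[of "0::'a" e] unfolding convex_def
    by (intro exI[of _ "ball 0 e"]) auto
qed

definition continuous_dual :: "('z::{real_vector,topological_space} \<Rightarrow> real) set" where
  "continuous_dual = {l. linear l \<and> continuous_on UNIV l}"

definition has_weak_integral ::
    "'w measure \<Rightarrow> ('w \<Rightarrow> 'z::{real_vector,topological_space}) \<Rightarrow> 'z \<Rightarrow> bool" where
  "has_weak_integral M Z e \<longleftrightarrow>
     (\<forall>l\<in>continuous_dual. integrable M (\<lambda>\<omega>. l (Z \<omega>)) \<and> l e = (\<integral>\<omega>. l (Z \<omega>) \<partial>M))"

definition weakly_integrable ::
    "'w measure \<Rightarrow> ('w \<Rightarrow> 'z::{real_vector,topological_space}) \<Rightarrow> bool" where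
  "weakly_integrable M Z \<longleftrightarrow> (\<exists>e. has_weak_integral M Z e)"

(* There is at most one such e in a Hausdorff locally convex space, since the continuous dual
   separates points. *)
definition weak_expectation ::
    "'w measure \<Rightarrow> ('w \<Rightarrow> 'z::{real_vector,topological_space}) \<Rightarrow> 'z" where
  "weak_expectation M Z = (THE e. has_weak_integral M Z e)"

(* A function on K is represented by a total function; only its values on K enter. *)
definition graph_on :: "'x set \<Rightarrow> ('x \<Rightarrow> 'y) \<Rightarrow> ('x \<times> 'y) set" where
  "graph_on K f = {(x, f x) |x. x \<in> K}"

definition fibre :: "('x \<times> 'y) set \<Rightarrow> 'x \<Rightarrow> 'y set" where
  "fibre M x = {y. (x, y) \<in> M}"

(* le is an extension of the arbitrary relation R to the space with -infinity and +infinity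
   added. Comparisons such as +infinity against a finite y, or between the added elements,
   are left unconstrained, so that every convention for them is covered. *)
definition extends_relation ::
    "('y \<Rightarrow> 'y \<Rightarrow> bool) \<Rightarrow> ('y extended \<Rightarrow> 'y extended \<Rightarrow> bool) \<Rightarrow> bool" where
  "extends_relation R le \<longleftrightarrow>
     (\<forall>a b. le (Fin a) (Fin b) \<longleftrightarrow> R a b) \<and> (\<forall>y. le Minf (Fin y) \<and> le (Fin y) Pinf)"

lemma extends_relation_order:
  "extends_relation (\<le>) ((\<le>) :: 'y::order extended \<Rightarrow> 'y extended \<Rightarrow> bool)"
  by (simp add: extends_relation_def)

end

theory Submission
  imports Defs
begin

text \<open>
  Let \<open>e\<close> be the weak expectation of \<open>(X, f(X))\<close>, whose components are the expectations of \<open>X\<close> and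
  \<open>f(X)\<close>. Everything rests on locating \<open>e\<close>: it lies in the closed convex hull of the graph, and in
  finite dimensions in the convex hull itself. The bounds follow by evaluating the hypothesis on
  \<open>g_l\<close> and \<open>g_u\<close> at this one point.

  In a locally convex space, a point outside the closed convex hull is strictly separated from it by
  a continuous functional \<open>l\<close>, and integrating \<open>l(X, f(X)) \<le> l(e) - d\<close> gives \<open>l(e) \<le> l(e) - d\<close>, a
  contradiction (\<open>weak_integral_in_closure_convex_hull\<close>). The separation theorem is derived from a
  Hahn-Banach theorem for sublinear functionals applied to a Minkowski functional. The
  Hahn-Banach theorem needs no extension of partial functionals: a minimal sublinear functional
  below a given one exists by Zorn's lemma and is automatically linear. In finite dimensions, a
  properly separating hyperplane and a descent on the dimension remove the closure
  (\<open>weak_integral_in_convex_hull\<close>).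

  For sharpness, the fibres of a convex set in the product with \<open>\<real>\<close> are intervals, so \<open>(x, y)\<close> with \<open>y\<close> strictly
  between the infimum and supremum of the fibre over \<open>x\<close> lies in the (closed) convex hull of the graph.
  Points of the convex hull are expectations of finitely supported random variables
  (\<open>convex_hull_attained\<close>), and a point of its closure is approximated by such points.
\<close>

section \<open>Topological vector spaces\<close>

lemma tendsto_scaleR_tvs:
  fixes b :: "'a::hausdorff_tvs"
  assumes "(f \<longlongrightarrow> a) F" "(g \<longlongrightarrow> b) F"
  shows "((\<lambda>x. f x *\<^sub>R g x) \<longlongrightarrow> a *\<^sub>R b) F"
  using filterlim_compose[OF tendsto_scaleR_nhds filterlim_Pair[OF assms]] by simp

lemma continuous_on_scaleR_tvs:
  fixes g :: "'b::topological_space \<Rightarrow> 'a::hausdorff_tvs"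
  assumes "continuous_on S f" "continuous_on S g"
  shows "continuous_on S (\<lambda>x. f x *\<^sub>R g x)"
  using assms unfolding continuous_on_def by (auto intro: tendsto_scaleR_tvs)

lemma absorbing_open:
  fixes U :: "'a::hausdorff_tvs set"
  assumes "open U" "0 \<in> U"
  obtains t where "t > 0" "(1 / t) *\<^sub>R x \<in> U"
proof -
  have "((\<lambda>n. (1 / real (Suc n)) *\<^sub>R x) \<longlongrightarrow> 0 *\<^sub>R x) sequentially"
    by (rule tendsto_scaleR_tvs)
      (use LIMSEQ_inverse_real_of_nat in \<open>simp_all add: inverse_eq_divide\<close>)
  then have "eventually (\<lambda>n. (1 / real (Suc n)) *\<^sub>R x \<in> U) sequentially"
    using assms by (auto dest: topological_tendstoD)
  then obtain n where "(1 / real (Suc n)) *\<^sub>R x \<in> U"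
    by (meson eventually_sequentially order_refl)
  then show thesis using that[of "real (Suc n)"] by simp
qed

lemma convex_closure_tvs:
  fixes S :: "'a::hausdorff_tvs set"
  assumes "convex S"
  shows "convex (closure S)"
proof (rule convexI)
  fix x y and u v :: real
  assume xy: "x \<in> closure S" "y \<in> closure S" and uv: "0 \<le> u" "0 \<le> v" "u + v = 1"
  let ?h = "\<lambda>p::'a \<times> 'a. u *\<^sub>R fst p + v *\<^sub>R snd p"
  have "continuous_on (closure (S \<times> S)) ?h"
    by (intro continuous_on_add continuous_on_scaleR_tvs continuous_intros)
  moreover have "?h ` (S \<times> S) \<subseteq> closure S"
    using convexD[OF assms] uv closure_subset[of S] by auto
  ultimately have "?h ` closure (S \<times> S) \<subseteq> closure S"
    by (intro image_closure_subset) auto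
  then show "u *\<^sub>R x + v *\<^sub>R y \<in> closure S"
    using xy by (force simp: closure_Times)
qed

instance prod :: (topological_monoid_add, topological_monoid_add) topological_monoid_add
proof
  fix a b :: "'a \<times> 'b"
  have "((\<lambda>p. (fst (fst p) + fst (snd p), snd (fst p) + snd (snd p))) \<longlongrightarrow>
      (fst a + fst b, snd a + snd b)) (nhds a \<times>\<^sub>F nhds b)"
    by (intro tendsto_Pair tendsto_add tendsto_fst tendsto_snd filterlim_fst filterlim_snd)
  then show "((\<lambda>p. fst p + snd p) \<longlongrightarrow> a + b) (nhds a \<times>\<^sub>F nhds b)"
    by (simp add: plus_prod_def)
qed

instance prod :: (topological_group_add, topological_group_add) topological_group_add
proof
  fix a :: "'a \<times> 'b"
  have "((\<lambda>p. (- fst p, - snd p)) \<longlongrightarrow> (- fst a, - snd a)) (nhds a)"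
    by (intro tendsto_Pair tendsto_minus tendsto_fst tendsto_snd filterlim_ident)
  then show "(uminus \<longlongrightarrow> - a) (nhds a)"
    by (simp add: uminus_prod_def[abs_def])
qed

instance prod :: (topological_ab_group_add, topological_ab_group_add) topological_ab_group_add ..

instance prod :: (hausdorff_tvs, hausdorff_tvs) hausdorff_tvs
proof
  fix c :: real and x :: "'a \<times> 'b"
  have "((\<lambda>p. (fst p *\<^sub>R fst (snd p), fst p *\<^sub>R snd (snd p))) \<longlongrightarrow>
      (c *\<^sub>R fst x, c *\<^sub>R snd x)) (nhds c \<times>\<^sub>F nhds x)"
    by (intro tendsto_Pair tendsto_scaleR_tvs tendsto_fst tendsto_snd filterlim_fst filterlim_snd)
  then show "((\<lambda>p. fst p *\<^sub>R snd p) \<longlongrightarrow> c *\<^sub>R x) (nhds c \<times>\<^sub>F nhds x)"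
    by (simp add: scaleR_prod_def)
qed

instance prod :: (locally_convex_t2, locally_convex_t2) locally_convex_t2
proof
  fix U :: "('a \<times> 'b) set"
  assume "open U" "0 \<in> U"
  then obtain A B where AB: "open A" "open B" "0 \<in> A \<times> B" "A \<times> B \<subseteq> U"
    by (metis open_prod_elim)
  then have "0 \<in> A" "0 \<in> B" by (auto simp: zero_prod_def)
  then obtain V1 V2 where V: "convex V1" "0 \<in> interior V1" "V1 \<subseteq> A"
      "convex V2" "0 \<in> interior V2" "V2 \<subseteq> B"
    using convex_neighbourhood AB by metis
  have "convex (V1 \<times> V2)" using V by (intro convex_Times)
  moreover have "open (interior V1 \<times> interior V2)" by (intro open_Times open_interior)
  moreover have "interior V1 \<times> interior V2 \<subseteq> V1 \<times> V2"
    by (intro Sigma_mono interior_subset)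
  moreover have "V1 \<times> V2 \<subseteq> U" using V AB by blast
  ultimately show "\<exists>V W.
       (\<forall>x\<in>V. \<forall>y\<in>V. \<forall>u\<ge>0. \<forall>v\<ge>0. u + v = 1 \<longrightarrow> u *\<^sub>R x + v *\<^sub>R y \<in> V) \<and>
       open W \<and> 0 \<in> W \<and> W \<subseteq> V \<and> V \<subseteq> U"
    using V(2,5) unfolding convex_def
    by (intro exI[of _ "V1 \<times> V2"] exI[of _ "interior V1 \<times> interior V2"])
      (simp add: zero_prod_def)
qed

section \<open>Sublinear functionals\<close>

text \<open>Subadditive and positively homogeneous; the scalar \<open>0\<close> is included, so that \<open>p 0 = 0\<close>.\<close>

definition sublinear :: "('a::real_vector \<Rightarrow> real) \<Rightarrow> bool" where
  "sublinear p \<longleftrightarrow>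
     (\<forall>x y. p (x + y) \<le> p x + p y) \<and> (\<forall>c\<ge>0. \<forall>x. p (c *\<^sub>R x) = c * p x)"

lemma sublinear_add: "sublinear p \<Longrightarrow> p (x + y) \<le> p x + p y"
  by (simp add: sublinear_def)

lemma sublinear_scale: "sublinear p \<Longrightarrow> c \<ge> 0 \<Longrightarrow> p (c *\<^sub>R x) = c * p x"
  by (simp add: sublinear_def)

lemma sublinear_0: "sublinear p \<Longrightarrow> p 0 = 0"
  using sublinear_scale[of p 0 0] by simp

lemma sublinear_minus: "sublinear p \<Longrightarrow> - p (- x) \<le> p x"
  using sublinear_add[of p x "- x"] by (simp add: sublinear_0)

text \<open>A pointwise infimum is sublinear if the sets over which it is taken are compatible, up to
  smaller elements, with addition and scaling of the argument. This covers infima of chains of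
  sublinear functionals, the one-sided perturbations of a sublinear functional in one direction,
  and Minkowski functionals.\<close>

lemma sublinear_Inf:
  fixes A :: "'a::real_vector \<Rightarrow> real set"
  assumes ne: "\<And>x. A x \<noteq> {}" and bdd: "\<And>x. bdd_below (A x)"
    and add: "\<And>x y a b. a \<in> A x \<Longrightarrow> b \<in> A y \<Longrightarrow> \<exists>c\<in>A (x + y). c \<le> a + b"
    and scale: "\<And>x a c. a \<in> A x \<Longrightarrow> c > 0 \<Longrightarrow> \<exists>b\<in>A (c *\<^sub>R x). b \<le> c * a"
    and zero: "Inf (A 0) = 0"
  shows "sublinear (\<lambda>x. Inf (A x))"
proof -
  have le: "Inf (A x) \<le> a" if "b \<in> A x" "b \<le> a" for x a b
    using cInf_lower[OF that(1) bdd] that(2) by simp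
  have "Inf (A (x + y)) \<le> Inf (A x) + Inf (A y)" for x y
  proof -
    have "Inf (A (x + y)) - b \<le> a" if "a \<in> A x" "b \<in> A y" for a b
      using add[OF that] le[of _ "x + y"] by force
    then have "Inf (A (x + y)) - b \<le> Inf (A x)" if "b \<in> A y" for b
      using that by (intro cInf_greatest ne) auto
    then have "Inf (A (x + y)) - Inf (A x) \<le> b" if "b \<in> A y" for b
      using that by (simp add: algebra_simps)
    then have "Inf (A (x + y)) - Inf (A x) \<le> Inf (A y)"
      by (intro cInf_greatest ne) auto
    then show ?thesis by simp
  qed
  moreover have half: "Inf (A (c *\<^sub>R x)) \<le> c * Inf (A x)" if "c > 0" for c x
  proof -
    have "Inf (A (c *\<^sub>R x)) / c \<le> a" if "a \<in> A x" for a
    proof -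
      have "Inf (A (c *\<^sub>R x)) \<le> c * a" using scale[OF that \<open>c > 0\<close>] le by blast
      then show ?thesis using \<open>c > 0\<close> by (simp add: field_simps)
    qed
    then have "Inf (A (c *\<^sub>R x)) / c \<le> Inf (A x)" by (intro cInf_greatest ne) auto
    then show ?thesis using \<open>c > 0\<close> by (simp add: field_simps)
  qed
  moreover have "Inf (A (c *\<^sub>R x)) = c * Inf (A x)" if "c \<ge> 0" for c x
  proof (cases "c = 0")
    case False
    then have "c > 0" using that by simp
    from half[of "1 / c" "c *\<^sub>R x"] have "c * Inf (A x) \<le> Inf (A (c *\<^sub>R x))"
      using \<open>c > 0\<close> by (simp add: field_simps)
    then show ?thesis using half[OF \<open>c > 0\<close>] by (simp add: antisym)
  qed (simp add: zero)
  ultimately show ?thesis by (simp add: sublinear_def)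
qed

text \<open>For sublinear \<open>p\<close>, the largest sublinear functional below \<open>p\<close> whose value at \<open>- a\<close> is
  \<open>- p a\<close>, that is, which is linear on the line through \<open>a\<close> with the value \<open>p a\<close> at \<open>a\<close>.\<close>

definition straighten :: "('a::real_vector \<Rightarrow> real) \<Rightarrow> 'a \<Rightarrow> 'a \<Rightarrow> real" where
  "straighten p a x = Inf ((\<lambda>t. p (x + t *\<^sub>R a) - t * p a) ` {0..})"

lemma
  assumes p: "sublinear p"
  shows straighten_le: "t \<ge> 0 \<Longrightarrow> straighten p a x \<le> p (x + t *\<^sub>R a) - t * p a"
    and sublinear_straighten: "sublinear (straighten p a)"
proof -
  let ?A = "\<lambda>x. (\<lambda>t. p (x + t *\<^sub>R a) - t * p a) ` {0..}"
  have "- p (- x) \<le> p (x + t *\<^sub>R a) - t * p a" if "t \<ge> 0" for t x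
    using sublinear_add[OF p, of "x + t *\<^sub>R a" "- x"] sublinear_scale[OF p that, of a] by simp
  then have bdd: "bdd_below (?A x)" for x by (auto intro!: bdd_belowI)
  then show "t \<ge> 0 \<Longrightarrow> straighten p a x \<le> p (x + t *\<^sub>R a) - t * p a"
    unfolding straighten_def by (intro cInf_lower) auto
  have "sublinear (\<lambda>x. Inf (?A x))"
  proof (rule sublinear_Inf)
    fix x y u v assume "u \<in> ?A x" "v \<in> ?A y"
    then obtain s t where st: "s \<ge> 0" "t \<ge> 0" "u = p (x + s *\<^sub>R a) - s * p a"
        "v = p (y + t *\<^sub>R a) - t * p a" by auto
    have "p (x + y + (s + t) *\<^sub>R a) - (s + t) * p a \<le> u + v"
      using sublinear_add[OF p, of "x + s *\<^sub>R a" "y + t *\<^sub>R a"] st by (simp add: algebra_simps)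
    then show "\<exists>w\<in>?A (x + y). w \<le> u + v" using st by force
  next
    fix x u and c :: real assume "u \<in> ?A x" and c: "c > 0"
    then obtain s where s: "s \<ge> 0" "u = p (x + s *\<^sub>R a) - s * p a" by auto
    have "p (c *\<^sub>R x + (c * s) *\<^sub>R a) - (c * s) * p a = c * u"
      using sublinear_scale[OF p, of c "x + s *\<^sub>R a"] c s
      by (simp add: scaleR_add_right right_diff_distrib)
    then show "\<exists>w\<in>?A (c *\<^sub>R x). w \<le> c * u"
      using s c by (intro bexI[OF _ imageI[of "c * s"]]) auto
  next
    have "?A 0 = {0}" using sublinear_scale[OF p] by force
    then show "Inf (?A 0) = 0" by simp
  qed (use bdd in auto)
  then show "sublinear (straighten p a)" by (simp add: straighten_def[abs_def])
qed

text \<open>By minimality \<open>straighten q a = q\<close>, and evaluating this at \<open>t = 1\<close> gives the missing half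
  \<open>q x + q a \<le> q (x + a)\<close> of additivity.\<close>

lemma linear_of_minimal_sublinear:
  assumes q: "sublinear q" and min: "\<And>r. sublinear r \<Longrightarrow> r \<le> q \<Longrightarrow> r = q"
  shows "linear q"
proof -
  have "straighten q a = q" for a
    using straighten_le[OF q, of 0 a] by (intro min sublinear_straighten q) (auto simp: le_fun_def)
  then have add: "q (x + a) = q x + q a" for x a
    using straighten_le[OF q, of 1 a x] sublinear_add[OF q, of x a] by simp
  have neg: "q (- x) = - q x" for x
    using add[of x "- x"] by (simp add: sublinear_0[OF q])
  show ?thesis
  proof (rule linearI)
    show "q (c *\<^sub>R x) = c *\<^sub>R q x" for c x
    proof (cases "c \<ge> 0")
      case False
      then have "q ((- c) *\<^sub>R x) = (- c) * q x" by (intro sublinear_scale[OF q]) simp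
      then show ?thesis using neg[of "c *\<^sub>R x"] by simp
    qed (simp add: sublinear_scale[OF q])
  qed (rule add)
qed

lemma sublinear_dominates_linear:
  assumes p: "sublinear (p :: 'a::real_vector \<Rightarrow> real)"
  obtains l where "linear l" "l \<le> p"
proof -
  define S where "S = {q. sublinear q \<and> q \<le> p}"
  have po: "partial_order_on S (relation_of (\<ge>) S)"
    by (rule partial_order_on_relation_ofI) auto
  have "\<exists>m\<in>S. \<forall>q\<in>S. m \<ge> q \<longrightarrow> q = m"
  proof (rule predicate_Zorn[OF po])
    fix C assume C: "C \<in> Chains (relation_of (\<ge>) S)"
    then have CS: "C \<subseteq> S" by (rule Chains_relation_of)
    have total: "q \<le> r \<or> r \<le> q" if "q \<in> C" "r \<in> C" for q r
      using C that by (auto simp: Chains_def relation_of_def)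
    show "\<exists>u\<in>S. \<forall>q\<in>C. q \<ge> u"
    proof (cases "C = {}")
      case True
      then show ?thesis using p by (auto simp: S_def)
    next
      case False
      let ?A = "\<lambda>x. (\<lambda>q. q x) ` C"
      have sub: "sublinear q" "q x \<le> p x" if "q \<in> C" for q x
        using that CS by (auto simp: S_def le_fun_def)
      have "- p (- x) \<le> q x" if "q \<in> C" for q x
        using sublinear_minus[OF sub(1)[OF that], of x] sub(2)[OF that, of "- x"] by simp
      then have bdd: "bdd_below (?A x)" for x by (auto intro!: bdd_belowI)
      have "sublinear (\<lambda>x. Inf (?A x))"
      proof (rule sublinear_Inf)
        fix x y a b assume "a \<in> ?A x" "b \<in> ?A y"
        then obtain q r where qr: "q \<in> C" "r \<in> C" "a = q x" "b = r y" by auto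
        then obtain s where "s \<in> C" "s \<le> q" "s \<le> r" using total by blast
        then have "s (x + y) \<le> s x + s y" "s x \<le> a" "s y \<le> b"
          using sublinear_add[OF sub(1)[OF \<open>s \<in> C\<close>], of x y] qr by (auto simp: le_fun_def)
        then have "s (x + y) \<le> a + b" by linarith
        then show "\<exists>c\<in>?A (x + y). c \<le> a + b" using \<open>s \<in> C\<close> by auto
      next
        fix x a and c :: real assume "a \<in> ?A x" "c > 0"
        then show "\<exists>b\<in>?A (c *\<^sub>R x). b \<le> c * a"
          using sublinear_scale[OF sub(1)] by force
      next
        have "?A 0 = {0}" using False sublinear_0[OF sub(1)] by force
        then show "Inf (?A 0) = 0" by simp
      qed (use bdd False in auto)
      moreover have "Inf (?A x) \<le> q x" if "q \<in> C" for q x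
        using that bdd by (intro cInf_lower) auto
      moreover obtain q where "q \<in> C" using False by blast
      ultimately have "(\<lambda>x. Inf (?A x)) \<le> p" "\<forall>q\<in>C. q \<ge> (\<lambda>x. Inf (?A x))"
        using sub(2)[OF \<open>q \<in> C\<close>] by (auto simp: le_fun_def intro: order_trans[of _ "q _"])
      then show ?thesis
        using \<open>sublinear (\<lambda>x. Inf (?A x))\<close> by (auto simp: S_def)
    qed
  qed
  then obtain m where m: "m \<in> S" "\<And>q. q \<in> S \<Longrightarrow> q \<le> m \<Longrightarrow> q = m" by blast
  have "linear m"
    by (rule linear_of_minimal_sublinear) (use m order_trans in \<open>auto simp: S_def\<close>)
  then show thesis using m that by (auto simp: S_def)
qed

text \<open>A linear functional \<open>l\<close> below \<open>straighten p a\<close> satisfies \<open>l (- a) \<le> - p a\<close>, which together with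
  \<open>l a \<le> p a\<close> forces equality at \<open>a\<close>.\<close>

theorem Hahn_Banach_sublinear:
  assumes p: "sublinear (p :: 'a::real_vector \<Rightarrow> real)"
  obtains l where "linear l" "l \<le> p" "l a = p a"
proof -
  obtain l where l: "linear l" "l \<le> straighten p a"
    by (rule sublinear_dominates_linear[OF sublinear_straighten[OF p]])
  have le: "l x \<le> p x" for x
    using l(2) straighten_le[OF p, of 0 a x] by (auto simp: le_fun_def intro: order_trans)
  have "l (- a) \<le> - p a"
    using l(2) straighten_le[OF p, of 1 a "- a"] sublinear_0[OF p]
    by (auto simp: le_fun_def intro: order_trans)
  then have "l a = p a" using le[of a] linear_neg[OF l(1), of a] by simp
  then show thesis using that l le by (simp add: le_fun_def)
qed

section \<open>Separation of points from closed convex sets\<close>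

text \<open>The Minkowski functional of a set \<open>D\<close>. In a topological vector space the infimum is over a nonempty
  set whenever \<open>D\<close> is a neighbourhood of \<open>0\<close>.\<close>

definition minkowski :: "'a::real_vector set \<Rightarrow> 'a \<Rightarrow> real" where
  "minkowski D x = Inf {t. t > 0 \<and> (1 / t) *\<^sub>R x \<in> D}"

lemma
  fixes D :: "'a::hausdorff_tvs set"
  assumes D: "convex D" "0 \<in> interior D"
  shows sublinear_minkowski: "sublinear (minkowski D)"
    and minkowski_le_1: "x \<in> D \<Longrightarrow> minkowski D x \<le> 1"
    and minkowski_ge_1: "x \<notin> D \<Longrightarrow> minkowski D x \<ge> 1"
proof -
  let ?A = "\<lambda>x. {t. t > 0 \<and> (1 / t) *\<^sub>R x \<in> D}"
  have bdd: "bdd_below (?A x)" for x by (auto intro!: bdd_belowI[of _ 0])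
  have D0: "0 \<in> D" using D(2) interior_subset by blast
  have ne: "?A x \<noteq> {}" for x
    using absorbing_open[OF open_interior D(2), of x] interior_subset by blast
  have "sublinear (\<lambda>x. Inf (?A x))"
  proof (rule sublinear_Inf[OF ne bdd])
    fix x y s t assume st: "s \<in> ?A x" "t \<in> ?A y"
    have "(s / (s + t)) *\<^sub>R (1 / s) *\<^sub>R x + (t / (s + t)) *\<^sub>R (1 / t) *\<^sub>R y \<in> D"
      using st by (intro convexD[OF D(1)]) (auto simp: add_divide_distrib[symmetric])
    then have "s + t \<in> ?A (x + y)" using st by (simp add: scaleR_add_right)
    then show "\<exists>c\<in>?A (x + y). c \<le> s + t" by blast
  next
    fix x s and c :: real assume "s \<in> ?A x" "c > 0"
    then show "\<exists>b\<in>?A (c *\<^sub>R x). b \<le> c * s" by (intro bexI[of _ "c * s"]) auto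
  next
    have "?A 0 = {0<..}" using D0 by auto
    then show "Inf (?A 0) = 0" by simp
  qed
  then show "sublinear (minkowski D)" by (simp add: minkowski_def[abs_def])
  show "x \<in> D \<Longrightarrow> minkowski D x \<le> 1"
    unfolding minkowski_def using bdd by (intro cInf_lower) auto
  show "minkowski D x \<ge> 1" if "x \<notin> D"
    unfolding minkowski_def
  proof (intro cInf_greatest ne)
    fix t assume t: "t \<in> ?A x"
    show "1 \<le> t"
    proof (rule ccontr)
      assume "\<not> 1 \<le> t"
      then have "t *\<^sub>R (1 / t) *\<^sub>R x + (1 - t) *\<^sub>R 0 \<in> D"
        using t D0 by (intro convexD[OF D(1)]) auto
      then show False using t that by simp
    qed
  qed
qed

lemma linear_bounded_nbhd_continuous:
  fixes l :: "'a::hausdorff_tvs \<Rightarrow> real"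
  assumes l: "linear l" and V: "0 \<in> interior V" "\<And>v. v \<in> V \<Longrightarrow> l v \<le> 1"
  shows "l \<in> continuous_dual"
proof -
  have "(l \<longlongrightarrow> l x) (at x)" for x
  proof (rule tendstoI)
    fix e :: real assume e: "e > 0"
    define N where "N = {y. (2 / e) *\<^sub>R (y - x) \<in> interior V \<and> (2 / e) *\<^sub>R (x - y) \<in> interior V}"
    have "open ((\<lambda>y. (2 / e) *\<^sub>R (y - x)) -` interior V)"
      "open ((\<lambda>y. (2 / e) *\<^sub>R (x - y)) -` interior V)"
      by (intro open_vimage open_interior continuous_on_scaleR_tvs continuous_intros)+
    then have "open N" by (auto simp: N_def vimage_def Collect_conj_eq)
    moreover have "x \<in> N" using V by (simp add: N_def)
    ultimately have "eventually (\<lambda>y. y \<in> N) (at x)"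
      by (metis eventually_at_topological)
    then show "eventually (\<lambda>y. dist (l y) (l x) < e) (at x)"
    proof eventually_elim
      case (elim y)
      then have "l ((2 / e) *\<^sub>R (y - x)) \<le> 1" "l ((2 / e) *\<^sub>R (x - y)) \<le> 1"
        using interior_subset V(2) by (auto simp: N_def)
      then show ?case
        using e by (simp add: linear_cmul[OF l] linear_diff[OF l] dist_real_def field_simps)
    qed
  qed
  then show ?thesis
    using l by (simp add: continuous_dual_def continuous_on_def)
qed

text \<open>With \<open>c0 \<in> C\<close> and a convex neighbourhood \<open>V\<close> of \<open>0\<close> such that \<open>z - V\<close> misses \<open>C\<close>, the convex
  neighbourhood \<open>D = (C - c0) + V\<close> of \<open>0\<close> does not contain \<open>z - c0\<close>. A linear functional below
  the Minkowski functional of \<open>D\<close> that agrees with it at \<open>z - c0\<close> separates; it is continuous since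
  it is bounded above on \<open>V\<close>.\<close>

theorem separate_point_closed_convex:
  fixes C :: "'a::locally_convex_t2 set"
  assumes C: "convex C" "z \<notin> closure C"
  obtains l d where "l \<in> continuous_dual" "d > 0" "\<And>c. c \<in> C \<Longrightarrow> l c \<le> l z - d"
proof (cases "C = {}")
  case True
  have "(\<lambda>_::'a. 0::real) \<in> continuous_dual"
    by (auto simp: continuous_dual_def intro!: linearI)
  then show thesis using that[of "\<lambda>_. 0" 1] True by simp
next
  case False
  then obtain c0 where c0: "c0 \<in> C" by blast
  have "open ((\<lambda>v. z - v) -` (- closure C))"
    by (intro open_vimage continuous_intros) auto
  then obtain V where V: "convex V" "0 \<in> interior V" "V \<subseteq> (\<lambda>v. z - v) -` (- closure C)"
    using convex_neighbourhood C(2) by (metis ComplI diff_zero vimageI)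
  have V0: "0 \<in> V" using V interior_subset by blast
  define D where "D = (\<Union>x\<in>(\<lambda>c. c - c0) ` C. \<Union>y\<in>V. {x + y})"
  have "convex D" unfolding D_def
    by (intro convex_sums convex_translation_subtract C V)
  have VD: "V \<subseteq> D" using c0 by (force simp: D_def)
  then have "0 \<in> interior D" using V(2) interior_mono by blast
  note D = \<open>convex D\<close> this
  have z: "z - c0 \<notin> D"
  proof
    assume "z - c0 \<in> D"
    then obtain c v where "c \<in> C" "v \<in> V" "z - c0 = (c - c0) + v" by (auto simp: D_def)
    then have "z - v \<in> C" by (simp add: algebra_simps)
    then show False using V(3) \<open>v \<in> V\<close> closure_subset by blast
  qed
  obtain l where l: "linear l" "l \<le> minkowski D" "l (z - c0) = minkowski D (z - c0)"
    by (rule Hahn_Banach_sublinear[OF sublinear_minkowski[OF D]])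
  have lD: "l x \<le> 1" if "x \<in> D" for x
    using l(2) minkowski_le_1[OF D that] by (auto simp: le_fun_def intro: order_trans)
  have lz: "l (z - c0) \<ge> 1" using l(3) minkowski_ge_1[OF D z] by simp
  have cont: "l \<in> continuous_dual"
    by (rule linear_bounded_nbhd_continuous[OF l(1) V(2)]) (use lD VD in blast)
  \<comment> \<open>Since \<open>l\<close> does not vanish, it takes a positive value on \<open>V\<close>, which gives the strict gap.\<close>
  obtain t where t: "t > 0" "(1 / t) *\<^sub>R (z - c0) \<in> interior V"
    using absorbing_open[OF open_interior V(2)] by blast
  define v where "v = (1 / t) *\<^sub>R (z - c0)"
  have v: "v \<in> V" "l v > 0"
    using t lz interior_subset by (auto simp: v_def linear_cmul[OF l(1)])
  have "l c \<le> l z - l v" if "c \<in> C" for c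
  proof -
    have "(c - c0) + v \<in> D" using that v by (auto simp: D_def)
    from lD[OF this] lz show ?thesis
      by (simp add: linear_add[OF l(1)] linear_diff[OF l(1)])
  qed
  then show thesis using that cont v(2) by blast
qed

section \<open>Weak integrals\<close>

lemma weak_integral_unique:
  fixes Z :: "'w \<Rightarrow> 'z::locally_convex_t2"
  assumes "has_weak_integral M Z a" "has_weak_integral M Z b"
  shows "a = b"
proof (rule ccontr)
  assume "a \<noteq> b"
  then obtain l d where "l \<in> continuous_dual" "d > 0" "l a \<le> l b - d"
    using separate_point_closed_convex[of "{a}" b] by auto
  moreover from this have "l a = l b"
    using assms by (auto simp: has_weak_integral_def)
  ultimately show False by simp
qed

lemma weak_expectation_eq:
  fixes Z :: "'w \<Rightarrow> 'z::locally_convex_t2"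
  assumes "has_weak_integral M Z e"
  shows "weak_expectation M Z = e"
  unfolding weak_expectation_def using assms weak_integral_unique by (blast intro: the_equality)

lemma has_weak_integral_Pair:
  fixes X :: "'w \<Rightarrow> 'x::hausdorff_tvs" and Y :: "'w \<Rightarrow> 'y::hausdorff_tvs"
  assumes "has_weak_integral M (\<lambda>\<omega>. (X \<omega>, Y \<omega>)) (a, b)"
  shows "has_weak_integral M X a" "has_weak_integral M Y b"
proof -
  show "has_weak_integral M X a"
    unfolding has_weak_integral_def
  proof
    fix l :: "'x \<Rightarrow> real" assume l: "l \<in> continuous_dual"
    have "linear (\<lambda>p::'x \<times> 'y. l (fst p))"
      using linear_compose[OF linear_fst, of l] l by (simp add: continuous_dual_def comp_def)
    moreover have "continuous_on UNIV (\<lambda>p::'x \<times> 'y. l (fst p))"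
      by (rule continuous_on_compose2[of UNIV l, OF _ continuous_on_fst[OF continuous_on_id]])
        (use l in \<open>auto simp: continuous_dual_def\<close>)
    ultimately have l': "(\<lambda>p::'x \<times> 'y. l (fst p)) \<in> continuous_dual"
      by (simp add: continuous_dual_def)
    show "integrable M (\<lambda>\<omega>. l (X \<omega>)) \<and> l a = (\<integral>\<omega>. l (X \<omega>) \<partial>M)"
      using bspec[OF assms[unfolded has_weak_integral_def] l'] by simp
  qed
  show "has_weak_integral M Y b"
    unfolding has_weak_integral_def
  proof
    fix l :: "'y \<Rightarrow> real" assume l: "l \<in> continuous_dual"
    have "linear (\<lambda>p::'x \<times> 'y. l (snd p))"
      using linear_compose[OF linear_snd, of l] l by (simp add: continuous_dual_def comp_def)
    moreover have "continuous_on UNIV (\<lambda>p::'x \<times> 'y. l (snd p))"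
      by (rule continuous_on_compose2[of UNIV l, OF _ continuous_on_snd[OF continuous_on_id]])
        (use l in \<open>auto simp: continuous_dual_def\<close>)
    ultimately have l': "(\<lambda>p::'x \<times> 'y. l (snd p)) \<in> continuous_dual"
      by (simp add: continuous_dual_def)
    show "integrable M (\<lambda>\<omega>. l (Y \<omega>)) \<and> l b = (\<integral>\<omega>. l (Y \<omega>) \<partial>M)"
      using bspec[OF assms[unfolded has_weak_integral_def] l'] by simp
  qed
qed

lemma weak_expectation_Pair:
  fixes X :: "'w \<Rightarrow> 'x::locally_convex_t2" and Y :: "'w \<Rightarrow> 'y::locally_convex_t2"
  assumes "has_weak_integral M (\<lambda>\<omega>. (X \<omega>, Y \<omega>)) e"
  shows "(weak_expectation M X, weak_expectation M Y) = e"
proof -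
  have "has_weak_integral M (\<lambda>\<omega>. (X \<omega>, Y \<omega>)) (fst e, snd e)" using assms by simp
  from has_weak_integral_Pair[OF this] show ?thesis by (simp add: weak_expectation_eq)
qed

lemma weakly_integrable_Pair:
  fixes X :: "'w \<Rightarrow> 'x::locally_convex_t2" and Y :: "'w \<Rightarrow> 'y::locally_convex_t2"
  assumes "weakly_integrable M (\<lambda>\<omega>. (X \<omega>, Y \<omega>))"
  shows "has_weak_integral M (\<lambda>\<omega>. (X \<omega>, Y \<omega>)) (weak_expectation M X, weak_expectation M Y)"
proof -
  obtain e where "has_weak_integral M (\<lambda>\<omega>. (X \<omega>, Y \<omega>)) e"
    using assms unfolding weakly_integrable_def by blast
  then show ?thesis by (simp add: weak_expectation_Pair)
qed

theorem weak_integral_in_closure_convex_hull: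
  fixes Z :: "'w \<Rightarrow> 'z::locally_convex_t2"
  assumes M: "prob_space M" and Z: "Z \<in> space M \<rightarrow> S" and e: "has_weak_integral M Z e"
  shows "e \<in> closure (convex hull S)"
proof (rule ccontr)
  interpret prob_space M by fact
  assume "e \<notin> closure (convex hull S)"
  then obtain l d where l: "l \<in> continuous_dual" "d > 0"
      "\<And>c. c \<in> convex hull S \<Longrightarrow> l c \<le> l e - d"
    using separate_point_closed_convex[OF convex_convex_hull] by metis
  have int: "integrable M (\<lambda>\<omega>. l (Z \<omega>))" "l e = (\<integral>\<omega>. l (Z \<omega>) \<partial>M)"
    using e l(1) by (auto simp: has_weak_integral_def)
  have "(\<integral>\<omega>. l (Z \<omega>) \<partial>M) \<le> (\<integral>\<omega>. l e - d \<partial>M)"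
    using Z by (intro integral_mono int l(3) hull_inc) auto
  then show False using int(2) l(2) by (simp add: prob_space)
qed

text \<open>In finite dimensions no closure is needed. If \<open>e\<close> lay outside \<open>convex hull S\<close>, a properly
  separating hyperplane through \<open>e\<close> would contain \<open>Z\<close> almost surely, because a nonnegative function
  with integral \<open>0\<close> vanishes almost everywhere; then \<open>S\<close> can be replaced by its intersection with that
  hyperplane. Properness of the separation makes the affine dimension of \<open>insert e S\<close>
  drop, so the descent ends, at the latest with the empty set, where \<open>Z\<close> cannot lie almost surely.
  For its sake the condition that \<open>Z\<close> takes values in \<open>S\<close> is weakened to an almost sure one.\<close>

theorem weak_integral_in_convex_hull:
  fixes Z :: "'w \<Rightarrow> 'z::euclidean_space"
  assumes M: "prob_space M" and Z: "AE \<omega> in M. Z \<omega> \<in> S" and e: "has_weak_integral M Z e"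
  shows "e \<in> convex hull S"
  using Z
proof (induction "nat (aff_dim (insert e S))" arbitrary: S rule: less_induct)
  case less
  interpret prob_space M by fact
  show ?case
  proof (rule ccontr)
    assume notin: "e \<notin> convex hull S"
    have "S \<noteq> {}"
    proof
      assume "S = {}"
      then have "AE \<omega> in M. False" using less.prems by simp
      then show False by simp
    qed
    then obtain a b where ab: "e + a \<in> affine hull (insert e (convex hull S))" "a \<noteq> 0"
        "a \<bullet> e \<le> b" "\<And>x. x \<in> convex hull S \<Longrightarrow> a \<bullet> x \<ge> b"
      using separating_hyperplane_set_point_inaff[OF convex_convex_hull _ notin] by auto
    have "(\<lambda>x. a \<bullet> x) \<in> continuous_dual"
      by (auto simp: continuous_dual_def intro!: continuous_intros linearI inner_add_right)
    then have int: "integrable M (\<lambda>\<omega>. a \<bullet> Z \<omega>)" "a \<bullet> e = (\<integral>\<omega>. a \<bullet> Z \<omega> \<partial>M)"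
      using e by (auto simp: has_weak_integral_def)
    have nonneg: "AE \<omega> in M. 0 \<le> a \<bullet> Z \<omega> - a \<bullet> e"
      using less.prems
    proof eventually_elim
      case (elim \<omega>)
      then show ?case using ab(3) ab(4)[OF hull_inc] by fastforce
    qed
    have "AE \<omega> in M. a \<bullet> Z \<omega> - a \<bullet> e = 0"
      using nonneg int by (subst integral_nonneg_eq_0_iff_AE[symmetric]) (auto simp: prob_space)
    with less.prems have S': "AE \<omega> in M. Z \<omega> \<in> S \<inter> {x. a \<bullet> x = a \<bullet> e}" (is "AE \<omega> in M. _ \<in> ?S'")
      by eventually_elim auto
    have "affine hull (insert e ?S') \<subseteq> {x. a \<bullet> x = a \<bullet> e}"
      by (rule hull_minimal) (auto simp: affine_hyperplane)
    moreover have "a \<bullet> (e + a) \<noteq> a \<bullet> e" using ab(2) by (simp add: inner_add_right)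
    ultimately have "e + a \<notin> affine hull (insert e ?S')" by blast
    moreover have "e + a \<in> affine hull (insert e S)"
    proof -
      have "insert e (convex hull S) \<subseteq> affine hull (insert e S)"
        using convex_hull_subset_affine_hull[of S] hull_mono[of S "insert e S" affine]
        by (auto intro: hull_inc)
      then have "affine hull (insert e (convex hull S)) \<subseteq> affine hull (insert e S)"
        by (simp add: hull_minimal)
      then show ?thesis using ab(1) by blast
    qed
    moreover have "affine hull (insert e ?S') \<subseteq> affine hull (insert e S)"
      by (rule hull_mono) auto
    ultimately have "aff_dim (insert e ?S') < aff_dim (insert e S)"
      by (intro aff_dim_psubset) blast
    moreover have "aff_dim (insert e ?S') \<ge> 0" using aff_dim_subset[of "{e}" "insert e ?S'"] by simp
    ultimately have "e \<in> convex hull ?S'" by (intro less.hyps S') simp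
    then show False using notin hull_mono[of ?S' S convex] by blast
  qed
qed

section \<open>Sharpness\<close>

text \<open>Every point of the convex hull of the graph is the joint expectation of a finitely supported
  random variable, here on a weighted finite set of reals.\<close>

lemma convex_hull_attained:
  fixes K :: "'x::locally_convex_t2 set" and f :: "'x \<Rightarrow> 'y::locally_convex_t2"
  assumes "p \<in> convex hull (graph_on K f)"
  obtains M :: "real measure" and X where "prob_space M" "X \<in> space M \<rightarrow> K"
    "weakly_integrable M (\<lambda>\<omega>. (X \<omega>, f (X \<omega>)))"
    "(weak_expectation M X, weak_expectation M (\<lambda>\<omega>. f (X \<omega>))) = p"
proof -
  obtain k u z where u: "\<And>i. i \<in> {1..k::nat} \<Longrightarrow> 0 \<le> u i" "sum u {1..k} = 1"
      and z: "\<And>i. i \<in> {1..k} \<Longrightarrow> z i \<in> graph_on K f" "(\<Sum>i=1..k. u i *\<^sub>R z i) = p"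
    using assms unfolding convex_hull_indexed mem_Collect_eq by metis
  \<comment> \<open>The index \<open>i\<close> is encoded as the real number \<open>i\<close> and decoded by the floor function.\<close>
  define A where "A = real ` {1..k}"
  define w where "w = (\<lambda>t::real. u (nat \<lfloor>t\<rfloor>))"
  define X where "X = (\<lambda>t::real. fst (z (nat \<lfloor>t\<rfloor>)))"
  define M where "M = point_measure A (\<lambda>t. ennreal (w t))"
  have sumA: "sum g A = (\<Sum>i=1..k. g (real i))" for g :: "real \<Rightarrow> real"
    unfolding A_def by (subst sum.reindex) auto
  have finA: "finite A" and w0: "\<And>t. t \<in> A \<Longrightarrow> w t \<ge> 0"
    using u by (auto simp: A_def w_def)
  have "(\<Sum>t\<in>A. ennreal (w t)) = ennreal (\<Sum>t\<in>A. w t)"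
    by (rule sum_ennreal) (use w0 in auto)
  also have "\<dots> = 1" using u by (simp add: sumA w_def)
  finally have "prob_space M" unfolding M_def using finA
    by (intro prob_spaceI) (simp add: emeasure_point_measure_finite space_point_measure)
  moreover have XK: "X \<in> space M \<rightarrow> K"
    using z(1) by (force simp: M_def space_point_measure A_def X_def graph_on_def)
  moreover have "has_weak_integral M (\<lambda>t. (X t, f (X t))) p"
    unfolding has_weak_integral_def
  proof (intro ballI conjI)
    fix l :: "'x \<times> 'y \<Rightarrow> real" assume "l \<in> continuous_dual"
    then have l: "linear l" by (simp add: continuous_dual_def)
    show "integrable M (\<lambda>t. l (X t, f (X t)))"
      unfolding M_def by (intro integrable_point_measure_finite finA)
    have "(X (real i), f (X (real i))) = z i" if "i \<in> {1..k}" for i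
      using z(1)[OF that] by (auto simp: X_def graph_on_def)
    then have "(\<integral>t. l (X t, f (X t)) \<partial>M) = (\<Sum>i=1..k. u i * l (z i))"
      using w0 finA unfolding M_def
      by (subst lebesgue_integral_point_measure_finite) (auto simp: sumA w_def intro!: sum.cong)
    also have "\<dots> = l p"
      by (simp add: z(2)[symmetric] linear_sum[OF l] linear_cmul[OF l])
    finally show "l p = (\<integral>t. l (X t, f (X t)) \<partial>M)" ..
  qed
  ultimately show thesis
    by (intro that weak_expectation_Pair)
      (auto simp: weakly_integrable_def simp del: split_paired_Ex)
qed

lemma convex_between_fibre_bounds:
  fixes S :: "('x::real_vector \<times> real) set"
  assumes S: "convex S"
    and y: "(INF y\<in>fibre S x. ereal y) < ereal y" "ereal y < (SUP y\<in>fibre S x. ereal y)"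
  shows "(x, y) \<in> S"
proof -
  obtain y1 y2 where y12: "y1 \<in> fibre S x" "y1 < y" "y2 \<in> fibre S x" "y < y2"
    using y by (auto simp: INF_less_iff less_SUP_iff)
  have "convex (fibre S x)"
  proof (rule convexI)
    fix s t u v :: real
    assume st: "s \<in> fibre S x" "t \<in> fibre S x" and uv: "0 \<le> u" "0 \<le> v" "u + v = 1"
    have "u *\<^sub>R (x, s) + v *\<^sub>R (x, t) \<in> S"
      using st uv by (intro convexD[OF S]) (auto simp: fibre_def)
    then show "u *\<^sub>R s + v *\<^sub>R t \<in> fibre S x"
      using uv by (simp add: fibre_def scaleR_add_left[symmetric])
  qed
  then have "y \<in> fibre S x"
    using y12 by (meson is_interval_convex_1 mem_is_interval_1_I less_imp_le)
  then show ?thesis by (simp add: fibre_def)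
qed

section \<open>Bounds for the expectation and their sharpness\<close>

theorem theorem3p4:
  shows
   "(\<forall>(M :: 'w measure) (R :: 'y::locally_convex_t2 \<Rightarrow> 'y \<Rightarrow> bool) le
       (K :: 'x::locally_convex_t2 set) (f :: 'x \<Rightarrow> 'y) (X :: 'w \<Rightarrow> 'x)
       (g_l :: 'x \<Rightarrow> 'y extended) (g_u :: 'x \<Rightarrow> 'y extended).
       prob_space M \<and> extends_relation R le \<and>
       X \<in> space M \<rightarrow> K \<and> weakly_integrable M (\<lambda>\<omega>. (X \<omega>, f (X \<omega>))) \<and>
       closure (convex hull (graph_on K f))
         \<subseteq> {(x, y). x \<in> closure (convex hull K) \<and> le (g_l x) (Fin y) \<and> le (Fin y) (g_u x)}
       \<longrightarrow> le (g_l (weak_expectation M X)) (Fin (weak_expectation M (\<lambda>\<omega>. f (X \<omega>)))) \<and>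
           le (Fin (weak_expectation M (\<lambda>\<omega>. f (X \<omega>)))) (g_u (weak_expectation M X)))
    \<and>
    (\<forall>(M :: 'w measure) (R :: 'n::euclidean_space \<Rightarrow> 'n \<Rightarrow> bool) le
       (K :: 'm::euclidean_space set) (f :: 'm \<Rightarrow> 'n) (X :: 'w \<Rightarrow> 'm)
       (g_l :: 'm \<Rightarrow> 'n extended) (g_u :: 'm \<Rightarrow> 'n extended).
       prob_space M \<and> extends_relation R le \<and>
       X \<in> space M \<rightarrow> K \<and> weakly_integrable M (\<lambda>\<omega>. (X \<omega>, f (X \<omega>))) \<and>
       convex hull (graph_on K f)
         \<subseteq> {(x, y). x \<in> convex hull K \<and> le (g_l x) (Fin y) \<and> le (Fin y) (g_u x)}
       \<longrightarrow> le (g_l (weak_expectation M X)) (Fin (weak_expectation M (\<lambda>\<omega>. f (X \<omega>)))) \<and>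
           le (Fin (weak_expectation M (\<lambda>\<omega>. f (X \<omega>)))) (g_u (weak_expectation M X)))
    \<and>
    (\<forall>(K :: 'm::euclidean_space set) (f :: 'm \<Rightarrow> real) (g_l :: 'm \<Rightarrow> ereal) (g_u :: 'm \<Rightarrow> ereal).
       (\<forall>x\<in>convex hull K.
          g_l x = (INF y\<in>fibre (convex hull (graph_on K f)) x. ereal y) \<and>
          g_u x = (SUP y\<in>fibre (convex hull (graph_on K f)) x. ereal y))
       \<longrightarrow> (\<forall>x\<in>convex hull K. \<forall>y::real. g_l x < ereal y \<and> ereal y < g_u x \<longrightarrow>
             (\<exists>(M' :: real measure) (X' :: real \<Rightarrow> 'm).
                prob_space M' \<and> X' \<in> space M' \<rightarrow> K \<and>
                weakly_integrable M' (\<lambda>\<omega>. (X' \<omega>, f (X' \<omega>))) \<and>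
                (weak_expectation M' X', weak_expectation M' (\<lambda>\<omega>. f (X' \<omega>))) = (x, y))))
    \<and>
    (\<forall>(K :: 'x set) (f :: 'x \<Rightarrow> real) (g_l :: 'x \<Rightarrow> ereal) (g_u :: 'x \<Rightarrow> ereal).
       (\<forall>x\<in>closure (convex hull K).
          g_l x = (INF y\<in>fibre (closure (convex hull (graph_on K f))) x. ereal y) \<and>
          g_u x = (SUP y\<in>fibre (closure (convex hull (graph_on K f))) x. ereal y))
       \<longrightarrow> (\<forall>x\<in>closure (convex hull K). \<forall>y::real. g_l x < ereal y \<and> ereal y < g_u x \<longrightarrow>
             (\<forall>U. (x, y) \<in> interior U \<longrightarrow>
               (\<exists>(M' :: real measure) (X' :: real \<Rightarrow> 'x).
                  prob_space M' \<and> X' \<in> space M' \<rightarrow> K \<and>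
                  weakly_integrable M' (\<lambda>\<omega>. (X' \<omega>, f (X' \<omega>))) \<and>
                  (weak_expectation M' X', weak_expectation M' (\<lambda>\<omega>. f (X' \<omega>))) \<in> U))))"
proof (intro conjI, goal_cases)
  case 1
  show ?case
  proof (intro allI impI; elim conjE)
    fix M :: "'w measure" and R :: "'y \<Rightarrow> 'y \<Rightarrow> bool" and le and K :: "'x set"
      and f :: "'x \<Rightarrow> 'y" and X g_l g_u
    assume M: "prob_space M" and X: "X \<in> space M \<rightarrow> K"
      and int: "weakly_integrable M (\<lambda>\<omega>. (X \<omega>, f (X \<omega>)))"
      and sub: "closure (convex hull (graph_on K f))
         \<subseteq> {(x, y). x \<in> closure (convex hull K) \<and> le (g_l x) (Fin y) \<and> le (Fin y) (g_u x)}"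
    have "(weak_expectation M X, weak_expectation M (\<lambda>\<omega>. f (X \<omega>)))
        \<in> closure (convex hull (graph_on K f))"
      using X by (intro weak_integral_in_closure_convex_hull[OF M _ weakly_integrable_Pair[OF int]])
        (auto simp: graph_on_def)
    with sub show "le (g_l (weak_expectation M X)) (Fin (weak_expectation M (\<lambda>\<omega>. f (X \<omega>)))) \<and>
           le (Fin (weak_expectation M (\<lambda>\<omega>. f (X \<omega>)))) (g_u (weak_expectation M X))"
      by auto
  qed
next
  case 2
  show ?case
  proof (intro allI impI; elim conjE)
    fix M :: "'w measure" and R :: "'n \<Rightarrow> 'n \<Rightarrow> bool" and le and K :: "'m set"
      and f :: "'m \<Rightarrow> 'n" and X g_l g_u
    assume M: "prob_space M" and X: "X \<in> space M \<rightarrow> K"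
      and int: "weakly_integrable M (\<lambda>\<omega>. (X \<omega>, f (X \<omega>)))"
      and sub: "convex hull (graph_on K f)
         \<subseteq> {(x, y). x \<in> convex hull K \<and> le (g_l x) (Fin y) \<and> le (Fin y) (g_u x)}"
    have "(weak_expectation M X, weak_expectation M (\<lambda>\<omega>. f (X \<omega>)))
        \<in> convex hull (graph_on K f)"
      using X by (intro weak_integral_in_convex_hull[OF M AE_I2 weakly_integrable_Pair[OF int]])
        (auto simp: graph_on_def)
    with sub show "le (g_l (weak_expectation M X)) (Fin (weak_expectation M (\<lambda>\<omega>. f (X \<omega>)))) \<and>
           le (Fin (weak_expectation M (\<lambda>\<omega>. f (X \<omega>)))) (g_u (weak_expectation M X))"
      by auto
  qed
next
  case 3
  show ?case
  proof (intro allI impI ballI; elim conjE)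
    fix K :: "'m set" and f :: "'m \<Rightarrow> real" and g_l g_u :: "'m \<Rightarrow> ereal" and x and y :: real
    assume g: "\<forall>x\<in>convex hull K.
          g_l x = (INF y\<in>fibre (convex hull (graph_on K f)) x. ereal y) \<and>
          g_u x = (SUP y\<in>fibre (convex hull (graph_on K f)) x. ereal y)"
      and x: "x \<in> convex hull K" and y: "g_l x < ereal y" "ereal y < g_u x"
    have "(x, y) \<in> convex hull (graph_on K f)"
      using g x y by (intro convex_between_fibre_bounds convex_convex_hull) auto
    then show "\<exists>(M' :: real measure) (X' :: real \<Rightarrow> 'm).
                prob_space M' \<and> X' \<in> space M' \<rightarrow> K \<and>
                weakly_integrable M' (\<lambda>\<omega>. (X' \<omega>, f (X' \<omega>))) \<and>
                (weak_expectation M' X', weak_expectation M' (\<lambda>\<omega>. f (X' \<omega>))) = (x, y)"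
      by (rule convex_hull_attained) blast
  qed
next
  case 4
  show ?case
  proof (intro allI impI ballI; elim conjE)
    fix K :: "'x set" and f :: "'x \<Rightarrow> real" and g_l g_u :: "'x \<Rightarrow> ereal" and x and y :: real and U
    assume g: "\<forall>x\<in>closure (convex hull K).
          g_l x = (INF y\<in>fibre (closure (convex hull (graph_on K f))) x. ereal y) \<and>
          g_u x = (SUP y\<in>fibre (closure (convex hull (graph_on K f))) x. ereal y)"
      and x: "x \<in> closure (convex hull K)" and y: "g_l x < ereal y" "ereal y < g_u x"
      and U: "(x, y) \<in> interior U"
    have "(x, y) \<in> closure (convex hull (graph_on K f))"
      using g x y by (intro convex_between_fibre_bounds convex_closure_tvs convex_convex_hull) auto
    then have "interior U \<inter> convex hull (graph_on K f) \<noteq> {}"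
      using U by (metis IntI empty_iff open_Int_closure_eq_empty open_interior)
    then obtain p where p: "p \<in> U" "p \<in> convex hull (graph_on K f)"
      using interior_subset by blast
    from p(2) obtain M :: "real measure" and X where "prob_space M" "X \<in> space M \<rightarrow> K"
        "weakly_integrable M (\<lambda>\<omega>. (X \<omega>, f (X \<omega>)))"
        "(weak_expectation M X, weak_expectation M (\<lambda>\<omega>. f (X \<omega>))) = p"
      by (rule convex_hull_attained)
    then show "\<exists>(M' :: real measure) (X' :: real \<Rightarrow> 'x).
                  prob_space M' \<and> X' \<in> space M' \<rightarrow> K \<and>
                  weakly_integrable M' (\<lambda>\<omega>. (X' \<omega>, f (X' \<omega>))) \<and>
                  (weak_expectation M' X', weak_expectation M' (\<lambda>\<omega>. f (X' \<omega>))) \<in> U"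
      using p(1) by blast
  qed
qed

end
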